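(* Let $A\in\mathbb{R}^{m\times c}$ and $B\in\mathbb{R}^{c}$. The set $\mathcal{U}=\{u\in\mathbb{R}^m \mid A^\top u\le B\}$ is non-empty if and only if the linear program $$\max_{\lambda\in\Lambda}\ \{-B^\top\lambda\},\qquad \Lambda=\{\lambda\in\mathbb{R}^c \mid A\lambda=0,\ \lambda\ge 0\},$$ is bounded.
   Context: Vector inequalities are element-wise. The linear program is called bounded if its objective is bounded from above on $\Lambda$, i.e. $\sup_{\lambda\in\Lambda}(-B^\top\lambda)<\infty$. *)

theory Defs
  imports "HOL-Analysis.Analysis"
begin

text \<open>
  A matrix with m rows and c columns has type \<open>real ^ 'c ^ 'm\<close>. The order \<open>\<le>\<close>
  on \<open>real ^ 'n\<close> is the component-wise one (\<open>less_eq_vec_def\<close>).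
\<close>

definition polyhedron_U :: "real ^ 'c ^ 'm \<Rightarrow> real ^ 'c \<Rightarrow> (real ^ 'm) set" where
  "polyhedron_U A B = {u. transpose A *v u \<le> B}"

definition lp_feasible :: "real ^ 'c ^ 'm \<Rightarrow> (real ^ 'c) set" where
  "lp_feasible A = {l. A *v l = 0 \<and> 0 \<le> l}"

definition lp_objective :: "real ^ 'c \<Rightarrow> real ^ 'c \<Rightarrow> real" where
  "lp_objective B l = - (B \<bullet> l)"

definition lp_bounded :: "real ^ 'c ^ 'm \<Rightarrow> real ^ 'c \<Rightarrow> bool" where
  "lp_bounded A B \<longleftrightarrow> bdd_above (lp_objective B ` lp_feasible A)"

end

(* Feasibility of A^T u \<le> B says that B lies in the finitely generated, hence closed, convex cone
   spanned by the vectors \<plusminus> A^T e_i and e_j. A hyperplane separating B from this cone has a normal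
   vector l with A l = 0, l \<ge> 0 and B \<bullet> l < 0, and then the objective is unbounded on the ray
   through l. The converse is weak duality, with 0 as the bound. *)

theory Submission
  imports Defs
begin

text \<open>A finitely generated cone is closed, so a hyperplane strictly separates \<open>z\<close>
  from it at some level \<open>b\<close>. Since 0 lies in the cone, \<open>b < 0\<close>; invariance
  under scaling then lifts the bound on the generators from \<open>b\<close> to 0.\<close>

lemma separating_convex_cone_hull:
  fixes S :: "'a :: euclidean_space set"
  assumes "finite S" and "z \<notin> convex_cone hull S"
  obtains a where "a \<bullet> z < 0" and "\<And>x. x \<in> S \<Longrightarrow> 0 \<le> a \<bullet> x"
proof -
  obtain a b where az: "a \<bullet> z < b" and sep: "\<And>x. x \<in> convex_cone hull S \<Longrightarrow> b < a \<bullet> x"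
    using separating_hyperplane_closed_point[OF convex_convex_cone_hull closed_convex_cone_hull] assms
    by metis
  have "b < 0"
    using sep[OF convex_cone_hull_contains_0] by simp
  have "0 \<le> a \<bullet> x" if "x \<in> S" for x
  proof (rule ccontr)
    assume "\<not> 0 \<le> a \<bullet> x"
    then have neg: "a \<bullet> x < 0"
      by simp
    \<comment> \<open>The factor is nonnegative as a quotient of two negative numbers, and it puts
      the inner product with \<open>a\<close> at exactly \<open>b\<close>, against the strict
      separation.\<close>
    then have "(b / (a \<bullet> x)) *\<^sub>R x \<in> convex_cone hull S"
      using \<open>b < 0\<close> that by (intro convex_cone_hull_mul hull_inc) (auto simp: divide_nonpos_neg)
    from sep[OF this] show False
      using neg by simp
  qed
  with az \<open>b < 0\<close> that show ?thesis
    by force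
qed

lemma inner_vec_nonneg:
  fixes x y :: "real ^ 'n"
  assumes "0 \<le> x" and "0 \<le> y"
  shows "0 \<le> x \<bullet> y"
  using assms by (auto simp: inner_vec_def less_eq_vec_def intro!: sum_nonneg)

lemma inner_transpose_matrix_vector:
  fixes A :: "real ^ 'c ^ 'm"
  shows "l \<bullet> (transpose A *v u) = u \<bullet> (A *v l)"
  by (metis dot_lmul_matrix inner_commute transpose_matrix_vector)

text \<open>This reduces the inclusion of a generated cone in the set of feasible right-hand sides
  to a check on the generators.\<close>

lemma convex_cone_feasible_rhs:
  fixes M :: "real ^ 'm ^ 'c"
  shows "convex_cone {y. \<exists>u. M *v u \<le> y}"
  unfolding convex_cone_iff
proof (intro conjI ballI allI impI)
  show "0 \<in> {y. \<exists>u. M *v u \<le> y}"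
    by (auto intro!: exI[of _ 0])
next
  fix x y assume "x \<in> {y. \<exists>u. M *v u \<le> y}" "y \<in> {y. \<exists>u. M *v u \<le> y}"
  then obtain u v where "M *v u \<le> x" "M *v v \<le> y"
    by auto
  then have "M *v (u + v) \<le> x + y"
    by (auto simp: less_eq_vec_def matrix_vector_right_distrib intro: add_mono)
  then show "x + y \<in> {y. \<exists>u. M *v u \<le> y}"
    by blast
next
  fix x and c :: real assume "x \<in> {y. \<exists>u. M *v u \<le> y}" "0 \<le> c"
  then obtain u where "M *v u \<le> x"
    by auto
  then have "M *v (c *\<^sub>R u) \<le> c *\<^sub>R x"
    using \<open>0 \<le> c\<close> by (auto simp: less_eq_vec_def matrix_vector_mult_scaleR intro: mult_left_mono)
  then show "c *\<^sub>R x \<in> {y. \<exists>u. M *v u \<le> y}"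
    by blast
qed

lemma farkas_inequality:
  fixes A :: "real ^ 'c ^ 'm"
  assumes "\<nexists>u. transpose A *v u \<le> B"
  obtains l where "A *v l = 0" and "0 \<le> l" and "B \<bullet> l < 0"
proof -
  \<comment> \<open>Both signs of the rows of \<open>A\<close> generate all vectors
    \<open>transpose A *v u\<close> and will force \<open>A *v l = 0\<close>; the unit vectors
    generate the nonnegative slacks and will force \<open>0 \<le> l\<close>.\<close>
  define S :: "(real ^ 'c) set" where
    "S = range (\<lambda>i. transpose A *v axis i 1) \<union> range (\<lambda>i. - (transpose A *v axis i 1))
       \<union> range (\<lambda>j. axis j 1)"
  have "S \<subseteq> {y. \<exists>u. transpose A *v u \<le> y}"
  proof -
    have "\<exists>u. transpose A *v u \<le> - (transpose A *v axis i 1)" for i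
      by (rule exI[of _ "- axis i 1"]) (simp add: vec.neg del: transpose_matrix_vector)
    moreover have "\<exists>u. transpose A *v u \<le> axis j 1" for j
      by (rule exI[of _ 0]) (auto simp: less_eq_vec_def axis_def)
    ultimately show ?thesis
      unfolding S_def by blast
  qed
  then have "convex_cone hull S \<subseteq> {y. \<exists>u. transpose A *v u \<le> y}"
    by (intro hull_minimal convex_cone_feasible_rhs)
  with assms have "B \<notin> convex_cone hull S"
    by blast
  moreover have "finite S"
    by (simp add: S_def)
  ultimately obtain l where neg: "l \<bullet> B < 0" and l: "\<And>x. x \<in> S \<Longrightarrow> 0 \<le> l \<bullet> x"
    using separating_convex_cone_hull by blast
  have "(A *v l) $ i = 0" for i
  proof -
    \<comment> \<open>Moving the transpose across the inner product turns these into the two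
      inequalities \<plusminus>\<open>(A *v l) $ i\<close> \<ge> 0.\<close>
    have "0 \<le> l \<bullet> (transpose A *v axis i 1)" "0 \<le> l \<bullet> (- (transpose A *v axis i 1))"
      by (rule l, unfold S_def, blast)+
    then show ?thesis
      by (simp add: inner_transpose_matrix_vector inner_axis' del: transpose_matrix_vector)
  qed
  moreover have "0 \<le> l $ j" for j
    using l[of "axis j 1"] by (simp add: S_def inner_axis)
  ultimately show ?thesis
    using neg by (intro that[of l]) (simp_all add: vec_eq_iff less_eq_vec_def inner_commute)
qed

theorem theorem1:
  fixes A :: "real ^ 'c ^ 'm" and B :: "real ^ 'c"
  shows "polyhedron_U A B \<noteq> {} \<longleftrightarrow> lp_bounded A B"
proof
  assume "polyhedron_U A B \<noteq> {}"
  then obtain u where u: "transpose A *v u \<le> B"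
    by (auto simp: polyhedron_U_def)
  have "lp_objective B l \<le> 0" if "l \<in> lp_feasible A" for l
  proof -
    \<comment> \<open>Pair \<open>l\<close> with the slack of \<open>u\<close>; the part with
      \<open>u\<close> vanishes because \<open>A *v l = 0\<close>.\<close>
    have "0 \<le> l \<bullet> (B - transpose A *v u)"
      using that u by (intro inner_vec_nonneg) (auto simp: lp_feasible_def less_eq_vec_def)
    also have "\<dots> = l \<bullet> B"
      using that
      by (simp add: inner_diff_right inner_transpose_matrix_vector lp_feasible_def
          del: transpose_matrix_vector)
    finally show ?thesis
      by (simp add: lp_objective_def inner_commute)
  qed
  then show "lp_bounded A B"
    unfolding lp_bounded_def by (intro bdd_aboveI2)
next
  assume "lp_bounded A B"
  then obtain M where M: "\<And>l. l \<in> lp_feasible A \<Longrightarrow> lp_objective B l \<le> M"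
    by (auto simp: lp_bounded_def bdd_above_def)
  show "polyhedron_U A B \<noteq> {}"
  proof
    assume "polyhedron_U A B = {}"
    then have "\<nexists>u. transpose A *v u \<le> B"
      unfolding polyhedron_U_def by blast
    then obtain l where l: "A *v l = 0" "0 \<le> l" and neg: "B \<bullet> l < 0"
      by (rule farkas_inequality)
    \<comment> \<open>Chosen so that the objective at \<open>t *\<^sub>R l\<close> is
      \<open>\<bar>M\<bar> + 1\<close>, which exceeds \<open>M\<close>; the absolute value keeps
      \<open>t\<close> nonnegative when \<open>M\<close> is negative.\<close>
    define t where "t = (\<bar>M\<bar> + 1) / - (B \<bullet> l)"
    have "0 \<le> t"
      using neg by (simp add: t_def divide_nonneg_neg)
    with l have "t *\<^sub>R l \<in> lp_feasible A"
      by (auto simp: lp_feasible_def less_eq_vec_def matrix_vector_mult_scaleR)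
    moreover have "lp_objective B (t *\<^sub>R l) = \<bar>M\<bar> + 1"
      using neg by (simp add: lp_objective_def t_def)
    ultimately show False
      using M by fastforce
  qed
qed

end
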